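(* Let $X$ be a real Banach space with $\dim (X) \geq 2$ and let $x \in B_X$. (a) For every rank-one operator $T = x^* \otimes x$ with $x^*\in X^*$, $\| x^* \| \geq 1$, we have $$\| \operatorname{Id} + T \| \geq (dc(x) - 1)\|x^*\| + 1.$$ (b) For every rank-one projection $P = x^* \otimes x$ with $x^* \in X^*$ satisfying $x^*(x)=1$, we have $$\| \operatorname{Id} - P \| \geq \delta c(x).$$
   Context: $B_X$, $S_X$, $X^*$ denote the closed unit ball, unit sphere and topological dual of $X$; $\operatorname{Id}$ is the identity on $X$; $x^*\otimes x$ is the operator $y\mapsto x^*(y)x$ on $X$. A slice of $B_X$ is a set $S(x^*,\delta)=\{y\in B_X : x^*(y)>1-\delta\}$ with $x^*\in S_{X^*}$ and $\delta>0$. For $x\in B_X$: The Daugavet constant $dc(x)$ is the supremum of all $\alpha\ge 0$ such that for all $\varepsilon,\delta>0$ and all $y^*\in S_{X^*}$ there exists $y\in S(y^*,\delta)$ with $\|y-x\|>\alpha-\varepsilon$. The $\Delta$-constant $\delta c(x)$ is the supremum of all $\alpha\ge 0$ such that for all $\varepsilon,\delta>0$ and all $y^*\in S_{X^*}$ with $x\in S(y^*,\delta)$ there exists $y\in S(y^*,\delta)$ with $\|y-x\|>\alpha-\varepsilon$. *)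

theory Defs
  imports "HOL-Analysis.Analysis"
begin

text \<open>The dual of \<open>'a\<close> is the type \<open>'a \<Rightarrow>\<^sub>L real\<close> with its operator norm, so its unit
  sphere is \<open>sphere 0 1\<close>.\<close>

definition slice :: "('a::real_normed_vector \<Rightarrow>\<^sub>L real) \<Rightarrow> real \<Rightarrow> 'a set" where
  "slice y' \<delta> = {y \<in> cball 0 1. blinfun_apply y' y > 1 - \<delta>}"

text \<open>In both constants below, if \<open>'a\<close> is nontrivial and \<open>norm x \<le> 1\<close>, the set of admissible
  \<open>\<alpha>\<close> contains \<open>0\<close> and is bounded above by \<open>2\<close>, so the supremum of reals is the true one.\<close>

definition daugavet_const :: "'a::real_normed_vector \<Rightarrow> real" where
  "daugavet_const x = Sup {\<alpha>. 0 \<le> \<alpha> \<and>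
     (\<forall>\<epsilon>>0. \<forall>\<delta>>0. \<forall>y'\<in>sphere (0::'a \<Rightarrow>\<^sub>L real) 1.
        \<exists>y\<in>slice y' \<delta>. norm (y - x) > \<alpha> - \<epsilon>)}"

definition delta_const :: "'a::real_normed_vector \<Rightarrow> real" where
  "delta_const x = Sup {\<alpha>. 0 \<le> \<alpha> \<and>
     (\<forall>\<epsilon>>0. \<forall>\<delta>>0. \<forall>y'\<in>sphere (0::'a \<Rightarrow>\<^sub>L real) 1.
        x \<in> slice y' \<delta> \<longrightarrow> (\<exists>y\<in>slice y' \<delta>. norm (y - x) > \<alpha> - \<epsilon>))}"

definition tensor_op :: "('a::real_normed_vector \<Rightarrow>\<^sub>L real) \<Rightarrow> 'a \<Rightarrow> ('a \<Rightarrow>\<^sub>L 'a)" where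
  "tensor_op x' x = blinfun_scaleR_left x o\<^sub>L x'"

lemma tensor_op_apply [simp]:
  "blinfun_apply (tensor_op x' x) y = blinfun_apply x' y *\<^sub>R x"
  by (simp add: tensor_op_def)

text \<open>\<open>dim\<close> is \<open>0\<close> on infinite-dimensional spaces, so value \<open>1\<close> does mean a one-dimensional range.\<close>

definition rank_one :: "('a::real_normed_vector \<Rightarrow>\<^sub>L 'a) \<Rightarrow> bool" where
  "rank_one T \<longleftrightarrow> dim (range (blinfun_apply T)) = 1"

definition is_projection :: "('a::real_normed_vector \<Rightarrow>\<^sub>L 'a) \<Rightarrow> bool" where
  "is_projection P \<longleftrightarrow> P o\<^sub>L P = P"

end

theory Submission
  imports Defs
begin

text \<open>
  For \<open>norm y \<le> 1\<close>, convexity of \<open>t \<mapsto> norm (y - t *\<^sub>R x)\<close>, which is at most \<open>1\<close> at \<open>t = 0\<close>, gives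
  \<open>norm (y - t *\<^sub>R x) \<ge> t * norm (y - x) - (t - 1)\<close> for \<open>t \<ge> 1\<close>. For (a), pick \<open>y\<close> far from \<open>x\<close> in a
  thin slice of \<open>- x' / norm x'\<close>, so that \<open>y + x' y *\<^sub>R x\<close> is almost \<open>y - norm x' *\<^sub>R x\<close>. For (b), pick \<open>y\<close>
  far from \<open>x\<close> with \<open>x' y > 1 - \<eta>\<close>, that is, in a slice that barely contains \<open>x\<close>; then
  \<open>y - x' y *\<^sub>R x\<close> has norm almost \<open>\<alpha>\<close> as soon as \<open>\<alpha> \<ge> 1\<close>. For \<open>\<alpha> < 1\<close> it suffices that
  \<open>Id - P\<close> is a projection, nonzero because the dimension is at least two.
\<close>

text \<open>The vector \<open>y - x\<close> is the convex combination of
  \<open>y - t *\<^sub>R x\<close> and \<open>y\<close> with weights \<open>1/t\<close> and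
  \<open>1 - 1/t\<close>; the proof is this identity multiplied by \<open>t\<close>.\<close>

lemma norm_diff_scaleR_ge:
  fixes x y :: "'a::real_normed_vector"
  assumes "norm y \<le> 1" "1 \<le> t"
  shows "t * norm (y - x) - (t - 1) \<le> norm (y - t *\<^sub>R x)"
proof -
  have "t * norm (y - x) = norm (t *\<^sub>R (y - x))"
    using assms by simp
  also have "\<dots> = norm ((y - t *\<^sub>R x) + (t - 1) *\<^sub>R y)"
    by (simp add: algebra_simps)
  also have "\<dots> \<le> norm (y - t *\<^sub>R x) + (t - 1) * norm y"
    using assms norm_triangle_ineq[of "y - t *\<^sub>R x" "(t - 1) *\<^sub>R y"] by simp
  also have "\<dots> \<le> norm (y - t *\<^sub>R x) + (t - 1)"
    using assms mult_left_le[of "norm y" "t - 1"] by simp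
  finally show ?thesis by linarith
qed

text \<open>Since \<open>norm x \<le> 1\<close>, the map
  \<open>t \<mapsto> norm (y - t *\<^sub>R x)\<close> is 1-Lipschitz. This pays for exchanging the
  actual coefficient of \<open>x\<close> with the ideal one that a thin slice only
  approximates.\<close>

lemma norm_diff_scaleR_perturb:
  fixes x y :: "'a::real_normed_vector"
  assumes "norm x \<le> 1"
  shows "norm (y - s *\<^sub>R x) - \<bar>s - t\<bar> \<le> norm (y - t *\<^sub>R x)"
proof -
  have "norm (y - s *\<^sub>R x) = norm ((y - t *\<^sub>R x) - (s - t) *\<^sub>R x)"
    by (simp add: algebra_simps)
  also have "\<dots> \<le> norm (y - t *\<^sub>R x) + \<bar>s - t\<bar> * norm x"
    using norm_triangle_ineq4[of "y - t *\<^sub>R x" "(s - t) *\<^sub>R x"] by simp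
  also have "\<dots> \<le> norm (y - t *\<^sub>R x) + \<bar>s - t\<bar>"
    using assms by (simp add: mult_left_le)
  finally show ?thesis by linarith
qed

lemma blinfun_apply_le_norm:
  fixes x' :: "'a::real_normed_vector \<Rightarrow>\<^sub>L 'b::real_normed_vector"
  assumes "norm y \<le> 1"
  shows "norm (blinfun_apply x' y) \<le> norm x'"
  using norm_blinfun[of x' y] mult_left_le[OF assms, of "norm x'"] by simp

text \<open>If the slice were empty, testing \<open>y'\<close> on the unit vectors
  \<open>sgn z\<close> and \<open>- sgn z\<close> would bound its operator norm by
  \<open>1 - \<delta>\<close>, which is below 1.\<close>

lemma slice_nonempty:
  fixes y' :: "'a::real_normed_vector \<Rightarrow>\<^sub>L real"
  assumes "norm y' = 1" "0 < \<delta>"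
  shows "slice y' \<delta> \<noteq> {}"
\<comment> \<open>An operator norm bound must be nonnegative, so \<open>1 - \<delta> < 0\<close> is
  treated apart; the slice then contains \<open>0\<close>.\<close>
proof (cases "1 < \<delta>")
  case True
  then have "0 \<in> slice y' \<delta>" by (simp add: slice_def)
  then show ?thesis by blast
next
  case False
  show ?thesis
  proof
    assume empty: "slice y' \<delta> = {}"
    have le: "blinfun_apply y' y \<le> 1 - \<delta>" if "norm y = 1" for y
    proof -
      have "y \<notin> slice y' \<delta>" using empty by simp
      then show ?thesis using that by (simp add: slice_def)
    qed
    have "norm (blinfun_apply y' z) \<le> (1 - \<delta>) * norm z" for z
    proof (cases "z = 0")
      case nz: False
      have "\<bar>blinfun_apply y' z\<bar> / norm z \<le> 1 - \<delta>"
        using le[of "sgn z"] le[of "- sgn z"] nz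
        by (simp add: sgn_div_norm norm_sgn blinfun.scaleR_right blinfun.minus_right
            divide_inverse abs_if mult.commute)
      then show ?thesis using nz by (simp add: divide_le_eq)
    qed simp
    then have "norm y' \<le> 1 - \<delta>"
      using False by (intro norm_blinfun_bound) auto
    then show False using assms by simp
  qed
qed

text \<open>Reduces a bound on the supremum to a bound on each admissible \<alpha>. A supremum of
  reals needs a nonempty set for this, and \<open>0\<close> is admissible because slices are
  nonempty.\<close>

lemma daugavet_const_le:
  fixes x :: "'a::real_normed_vector"
  assumes "\<And>\<alpha>. 0 \<le> \<alpha> \<Longrightarrow>
    (\<And>\<epsilon> \<delta> y'. 0 < \<epsilon> \<Longrightarrow> 0 < \<delta> \<Longrightarrow> norm (y' :: 'a \<Rightarrow>\<^sub>L real) = 1 \<Longrightarrow>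
      \<exists>y\<in>slice y' \<delta>. norm (y - x) > \<alpha> - \<epsilon>) \<Longrightarrow> \<alpha> \<le> c"
  shows "daugavet_const x \<le> c"
  unfolding daugavet_const_def
proof (rule cSup_least)
  have "\<exists>y\<in>slice y' \<delta>. norm (y - x) > 0 - \<epsilon>"
    if pos: "0 < \<epsilon>" "0 < \<delta>" "norm (y' :: 'a \<Rightarrow>\<^sub>L real) = 1" for \<epsilon> \<delta> :: real and y'
  proof -
    obtain y where "y \<in> slice y' \<delta>" using slice_nonempty[OF pos(3,2)] by blast
    moreover have "0 - \<epsilon> < norm (y - x)"
      using \<open>0 < \<epsilon>\<close> norm_ge_zero[of "y - x"] by linarith
    ultimately show ?thesis by blast
  qed
  then show "{\<alpha>. 0 \<le> \<alpha> \<and> (\<forall>\<epsilon>>0. \<forall>\<delta>>0. \<forall>y'\<in>sphere (0::'a \<Rightarrow>\<^sub>L real) 1.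
      \<exists>y\<in>slice y' \<delta>. norm (y - x) > \<alpha> - \<epsilon>)} \<noteq> {}"
    by (auto intro!: exI[of _ 0])
qed (use assms in auto)

lemma delta_const_le:
  fixes x :: "'a::real_normed_vector"
  assumes "\<And>\<alpha>. 0 \<le> \<alpha> \<Longrightarrow>
    (\<And>\<epsilon> \<delta> y'. 0 < \<epsilon> \<Longrightarrow> 0 < \<delta> \<Longrightarrow> norm (y' :: 'a \<Rightarrow>\<^sub>L real) = 1 \<Longrightarrow> x \<in> slice y' \<delta> \<Longrightarrow>
      \<exists>y\<in>slice y' \<delta>. norm (y - x) > \<alpha> - \<epsilon>) \<Longrightarrow> \<alpha> \<le> c"
  shows "delta_const x \<le> c"
  unfolding delta_const_def
proof (rule cSup_least)
  \<comment> \<open>Again \<open>0\<close> is admissible, now with \<open>x\<close> itself as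
    witness, since only slices containing \<open>x\<close> count.\<close>
  show "{\<alpha>. 0 \<le> \<alpha> \<and> (\<forall>\<epsilon>>0. \<forall>\<delta>>0. \<forall>y'\<in>sphere (0::'a \<Rightarrow>\<^sub>L real) 1.
      x \<in> slice y' \<delta> \<longrightarrow> (\<exists>y\<in>slice y' \<delta>. norm (y - x) > \<alpha> - \<epsilon>))} \<noteq> {}"
    by (auto intro!: exI[of _ 0] bexI[of _ x])
qed (use assms in auto)

text \<open>A nonzero projection fixes a nonzero vector, namely any nonzero
  \<open>Q z\<close>.\<close>

lemma norm_projection_ge_1:
  fixes Q :: "'a::real_normed_vector \<Rightarrow>\<^sub>L 'a"
  assumes "is_projection Q" "Q \<noteq> 0"
  shows "1 \<le> norm Q"
proof -
  obtain z where z: "blinfun_apply Q z \<noteq> 0"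
    using assms(2) by (metis blinfun_eqI zero_blinfun.rep_eq)
  have "blinfun_apply Q (blinfun_apply Q z) = blinfun_apply Q z"
    using assms(1) by (metis is_projection_def blinfun_apply_blinfun_compose)
  then have "norm (blinfun_apply Q z) \<le> norm Q * norm (blinfun_apply Q z)"
    by (metis norm_blinfun)
  then show ?thesis using z by simp
qed

text \<open>This is how dimension at least two enters: if \<open>tensor_op x' x\<close> were the
  identity, \<open>span {x}\<close> would be the whole space.\<close>

lemma independent_pair_not_subset_span:
  assumes "u \<noteq> v" "independent {u, v :: 'a::real_vector}"
  shows "\<not> {u, v} \<subseteq> span {x}"
proof
  assume "{u, v} \<subseteq> span {x}"
  then have "card {u, v} \<le> card {x}"
    using independent_span_bound[of "{x}" "{u, v}"] assms(2) by auto
  then show False using assms(1) by simp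
qed

lemma norm_id_plus_tensor_op_ge:
  fixes x :: "'a::real_normed_vector"
  assumes x: "norm x \<le> 1" and x': "1 \<le> norm x'"
  shows "(daugavet_const x - 1) * norm x' + 1 \<le> norm (id_blinfun + tensor_op x' x)"
proof -
  define n where "n = norm x'"
  define B where "B = norm (id_blinfun + tensor_op x' x)"
  have n: "1 \<le> n" using x' by (simp add: n_def)
  \<comment> \<open>The claim solved for the constant, so that it becomes an upper bound on a
    supremum.\<close>
  have "daugavet_const x \<le> (B - 1) / n + 1"
  proof (rule daugavet_const_le)
    fix \<alpha> :: real
    assume adm: "\<And>\<epsilon> \<delta> y'. 0 < \<epsilon> \<Longrightarrow> 0 < \<delta> \<Longrightarrow> norm (y' :: 'a \<Rightarrow>\<^sub>L real) = 1 \<Longrightarrow>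
      \<exists>y\<in>slice y' \<delta>. norm (y - x) > \<alpha> - \<epsilon>"
    show "\<alpha> \<le> (B - 1) / n + 1"
    proof (rule field_le_epsilon)
      fix e :: real assume e: "0 < e"
      define y' where "y' = (- inverse n) *\<^sub>R x'"
      have "norm y' = 1" using n by (simp add: y'_def n_def[symmetric])
      \<comment> \<open>The error is split evenly: one half for the distance to \<open>x\<close>,
        the other for the slice, where \<open>- x' y\<close> misses \<open>n\<close> by less than
        \<open>n * (e/2)\<close>.\<close>
      then obtain y where y: "y \<in> slice y' (e/2)" "\<alpha> - e/2 < norm (y - x)"
        using adm[of "e/2" "e/2" y'] e by auto
      have y1: "norm y \<le> 1" using y(1) by (simp add: slice_def)
      have "1 - e/2 < blinfun_apply y' y" using y(1) by (simp add: slice_def)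
      then have "n * (1 - e/2) < n * blinfun_apply y' y"
        using n by (simp add: mult_strict_left_mono)
      also have "n * blinfun_apply y' y = - blinfun_apply x' y"
        using n by (simp add: y'_def blinfun.scaleR_left blinfun.minus_left)
      finally have s: "n - n * (e/2) < - blinfun_apply x' y"
        by (simp add: right_diff_distrib)
      have s': "- blinfun_apply x' y \<le> n"
        using blinfun_apply_le_norm[OF y1, of x'] by (simp add: n_def)
      have "n * (\<alpha> - e/2) - (n - 1) - n * (e/2) \<le> n * norm (y - x) - (n - 1) - n * (e/2)"
        using y(2) n by (simp add: mult_left_mono)
      also have "\<dots> \<le> norm (y - n *\<^sub>R x) - n * (e/2)"
        using norm_diff_scaleR_ge[OF y1 n, of x] by linarith
      also have "\<dots> \<le> norm (y - (- blinfun_apply x' y) *\<^sub>R x)"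
        using norm_diff_scaleR_perturb[OF x, of y n "- blinfun_apply x' y"] s s' by linarith
      also have "\<dots> = norm (blinfun_apply (id_blinfun + tensor_op x' x) y)"
        by (simp add: blinfun.add_left)
      also have "\<dots> \<le> B"
        unfolding B_def by (rule blinfun_apply_le_norm[OF y1])
      finally have "n * (\<alpha> - 1 - e) \<le> B - 1" by (simp add: algebra_simps)
      then have "\<alpha> - 1 - e \<le> (B - 1) / n" using n by (simp add: pos_le_divide_eq mult.commute)
      then show "\<alpha> \<le> (B - 1) / n + 1 + e" by simp
    qed
  qed
  then have "daugavet_const x - 1 \<le> (B - 1) / n" by simp
  then have "(daugavet_const x - 1) * n \<le> B - 1" using n by (simp add: pos_le_divide_eq)
  then show ?thesis by (simp add: n_def B_def)
qed

lemma norm_id_minus_tensor_op_ge: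
  fixes x :: "'a::real_normed_vector"
  assumes x: "norm x \<le> 1" and x'x: "blinfun_apply x' x = 1"
    and neq: "tensor_op x' x \<noteq> id_blinfun"
  shows "delta_const x \<le> norm (id_blinfun - tensor_op x' x)"
proof (rule delta_const_le)
  define n where "n = norm x'"
  define Q where "Q = id_blinfun - tensor_op x' x"
  have n: "1 \<le> n"
    using blinfun_apply_le_norm[OF x, of x'] x'x by (simp add: n_def)
  have "is_projection Q"
    unfolding is_projection_def Q_def
    by (rule blinfun_eqI) (simp add: blinfun.diff_left blinfun.diff_right blinfun.scaleR_right x'x)
  then have Q1: "1 \<le> norm Q"
    using neq by (intro norm_projection_ge_1) (auto simp: Q_def)
  fix \<alpha> :: real
  assume adm: "\<And>\<epsilon> \<delta> y'. 0 < \<epsilon> \<Longrightarrow> 0 < \<delta> \<Longrightarrow> norm (y' :: 'a \<Rightarrow>\<^sub>L real) = 1 \<Longrightarrow>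
    x \<in> slice y' \<delta> \<Longrightarrow> \<exists>y\<in>slice y' \<delta>. norm (y - x) > \<alpha> - \<epsilon>"
  have "\<alpha> \<le> norm Q"
  proof (cases "1 \<le> \<alpha>")
    case True
    show ?thesis
    proof (rule field_le_epsilon)
      fix e :: real assume e: "0 < e"
      define y' where "y' = inverse n *\<^sub>R x'"
      \<comment> \<open>After scaling by \<open>n\<close>, membership in this slice reads
        \<open>x' z > 1 - e/2\<close>, which \<open>x\<close> satisfies because
        \<open>x' x = 1\<close>.\<close>
      define \<delta> where "\<delta> = 1 - (1 - e/2) / n"
      have \<delta>: "0 < \<delta>" using n e by (simp add: \<delta>_def field_simps)
      have ny: "norm y' = 1" using n by (simp add: y'_def n_def[symmetric])
      have slice_iff: "z \<in> slice y' \<delta> \<longleftrightarrow> norm z \<le> 1 \<and> 1 - e/2 < blinfun_apply x' z" for z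
      proof -
        have "blinfun_apply y' z = blinfun_apply x' z / n"
          by (simp add: y'_def blinfun.scaleR_left divide_inverse mult.commute)
        then show ?thesis using n by (simp add: slice_def \<delta>_def divide_less_cancel)
      qed
      have "x \<in> slice y' \<delta>" using x x'x e by (simp add: slice_iff)
      \<comment> \<open>The distance error gets multiplied by \<open>s\<close> when
        \<open>s \<ge> 1\<close>, and \<open>s\<close> can be as large as \<open>n\<close>; hence
        the division by \<open>n\<close>.\<close>
      then obtain y where y: "y \<in> slice y' \<delta>" "\<alpha> - e / (2 * n) < norm (y - x)"
        using adm[of "e / (2 * n)" \<delta> y'] e n \<delta> ny by auto
      define s where "s = blinfun_apply x' y"
      have y1: "norm y \<le> 1" and s: "1 - e/2 < s" using y(1) by (auto simp: slice_iff s_def)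
      have sn: "s \<le> n" using blinfun_apply_le_norm[OF y1, of x'] by (simp add: n_def s_def)
      have "\<alpha> - e \<le> norm (y - s *\<^sub>R x)"
      proof (cases "1 \<le> s")
        case s1: True
        have "s * (e / (2 * n)) \<le> n * (e / (2 * n))"
          using sn e n by (intro mult_right_mono) auto
        also have "\<dots> \<le> e" using n e by simp
        finally have "s * (e / (2 * n)) \<le> e" .
        \<comment> \<open>The only use of \<open>\<alpha> \<ge> 1\<close>: it gives
          \<open>s * \<alpha> - (s - 1) \<ge> \<alpha>\<close>.\<close>
        moreover have "0 \<le> (s - 1) * (\<alpha> - 1)" using s1 True by simp
        ultimately have "\<alpha> - e \<le> s * (\<alpha> - e / (2 * n)) - (s - 1)"
          by (simp add: algebra_simps)
        also have "\<dots> \<le> s * norm (y - x) - (s - 1)"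
          using y(2) s1 by (simp add: mult_left_mono)
        also have "\<dots> \<le> norm (y - s *\<^sub>R x)"
          by (rule norm_diff_scaleR_ge[OF y1 s1])
        finally show ?thesis .
      next
        case False
        \<comment> \<open>Here \<open>1 - e/2 < s < 1\<close>, so changing the coefficient from 1 to
          \<open>s\<close> costs less than \<open>e/2\<close>, and the distance error is at most the
          other half.\<close>
        have "e / (2 * n) \<le> e / 2" using n e by (simp add: field_simps)
        then show ?thesis
          using norm_diff_scaleR_perturb[OF x, of y 1 s] False s y(2) by simp
      qed
      also have "\<dots> = norm (blinfun_apply Q y)"
        by (simp add: Q_def s_def blinfun.diff_left)
      also have "\<dots> \<le> norm Q" by (rule blinfun_apply_le_norm[OF y1])
      finally show "\<alpha> \<le> norm Q + e" by simp
    qed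
  next
    case False
    then show ?thesis using Q1 by simp
  qed
  then show "\<alpha> \<le> norm (id_blinfun - tensor_op x' x)" by (simp add: Q_def)
qed

theorem proposition2p4:
  fixes x :: "'a::banach"
  assumes dim_ge_2: "\<exists>u v::'a. u \<noteq> v \<and> independent {u, v}"
    and x_ball: "x \<in> cball 0 1"
  shows "(\<forall>(T::'a \<Rightarrow>\<^sub>L 'a) (x'::'a \<Rightarrow>\<^sub>L real).
            rank_one T \<and> T = tensor_op x' x \<and> norm x' \<ge> 1 \<longrightarrow>
            norm (id_blinfun + T) \<ge> (daugavet_const x - 1) * norm x' + 1)
       \<and> (\<forall>(P::'a \<Rightarrow>\<^sub>L 'a) (x'::'a \<Rightarrow>\<^sub>L real).
            rank_one P \<and> is_projection P \<and> P = tensor_op x' x \<and> blinfun_apply x' x = 1 \<longrightarrow>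
            norm (id_blinfun - P) \<ge> delta_const x)"
proof -
  have x: "norm x \<le> 1" using x_ball by simp
  have "tensor_op x' x \<noteq> id_blinfun" for x' :: "'a \<Rightarrow>\<^sub>L real"
  proof
    assume "tensor_op x' x = id_blinfun"
    then have "blinfun_apply x' z *\<^sub>R x = z" for z
      by (metis tensor_op_apply blinfun_apply_id_blinfun)
    then have "z \<in> span {x}" for z
      by (metis span_base span_scale singletonI)
    then show False
      using dim_ge_2 independent_pair_not_subset_span by blast
  qed
  then show ?thesis
    using norm_id_plus_tensor_op_ge[OF x] norm_id_minus_tensor_op_ge[OF x] by blast
qed

end
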